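(* Let $P\colon\mathcal{E}\to\mathcal{B}$ be a functor between small categories. (1) If $P$ is a Grothendieck opfibration, then $P$ is a right directed fibration. (2) Dually, if $P$ is a Grothendieck fibration, then $P$ is a left directed fibration. (3) Conversely to (1), suppose $P$ is a right directed fibration whose liftings can always be chosen with opcartesian components, i.e. for every small category $\mathcal{C}$, all functors $F',G'\colon\mathcal{C}\to\mathcal{B}$, every natural transformation $\alpha'\colon F'\Rightarrow G'$ and every functor $F\colon\mathcal{C}\to\mathcal{E}$ with $P F=F'$, there exist a functor $G\colon\mathcal{C}\to\mathcal{E}$ with $P G=G'$ and a natural transformation $\alpha\colon F\Rightarrow G$ with $P(\alpha_c)=\alpha'_c$ for all $c\in\mathcal{C}$ such that every component $\alpha_c$ is $P$-opcartesian. Then $P$ is a Grothendieck opfibration.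
   Context: All categories are small. Let $\mathbb{I}_1=\{0\to1\}$ be the walking arrow category, and for a category $\mathcal{C}$ and $\varepsilon\in\{0,1\}$ let $\iota_\varepsilon\colon\mathcal{C}\to\mathcal{C}\times\mathbb{I}_1$ be the functor $c\mapsto(c,\varepsilon)$. A functor $P\colon\mathcal{E}\to\mathcal{B}$ is a right directed fibration if for every small category $\mathcal{C}$ and all functors $F\colon\mathcal{C}\to\mathcal{E}$, $H\colon\mathcal{C}\times\mathbb{I}_1\to\mathcal{B}$ with $H\iota_0=PF$, there exists a functor $\widetilde H\colon\mathcal{C}\times\mathbb{I}_1\to\mathcal{E}$ with $P\widetilde H=H$ and $\widetilde H\iota_0=F$. It is a left directed fibration if the same holds with $\iota_1$ in place of $\iota_0$. Equivalently (right case): given $\alpha'\colon F'\Rightarrow G'$ between functors $\mathcal{C}\to\mathcal{B}$ and $F$ with $PF=F'$, there exist $G$ with $PG=G'$ and $\alpha\colon F\Rightarrow G$ with $P(\alpha_c)=\alpha'_c$ for every $c$. A morphism $\varphi\colon e_1\to e_2$ in $\mathcal{E}$ is $P$-opcartesian if for every morphism $\beta\colon e_1\to e$ in $\mathcal{E}$ and every $\overline\alpha\colon P(e_2)\to P(e)$ with $\overline\alpha\circ P(\varphi)=P(\beta)$, there is a unique $\alpha\colon e_2\to e$ with $\alpha\circ\varphi=\beta$ and $P(\alpha)=\overline\alpha$. $P$ is a Grothendieck opfibration if for every morphism $\overline\varphi\colon b_1\to b_2$ in $\mathcal{B}$ and every $e_1\in\mathcal{E}$ with $P(e_1)=b_1$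 there is a $P$-opcartesian morphism $\varphi\colon e_1\to e_2$ with $P(\varphi)=\overline\varphi$. $P$ is a Grothendieck fibration if $P^{\mathrm{op}}\colon\mathcal{E}^{\mathrm{op}}\to\mathcal{B}^{\mathrm{op}}$ is a Grothendieck opfibration. (The axiom of choice is allowed.) *)

theory Defs imports Main begin

text \<open>A category carried by a set of objects and a set of arrows inside two types.
  Composition is written in the usual order: \<open>Comp C g f\<close> is \<open>g\<close> after \<open>f\<close>. The operations
  are unconstrained outside of the carriers.\<close>

record ('o, 'a) cat =
  Ob :: "'o set"
  Ar :: "'a set"
  Dom :: "'a \<Rightarrow> 'o"
  Cod :: "'a \<Rightarrow> 'o"
  Id :: "'o \<Rightarrow> 'a"
  Comp :: "'a \<Rightarrow> 'a \<Rightarrow> 'a"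

definition Hom :: "('o, 'a) cat \<Rightarrow> 'o \<Rightarrow> 'o \<Rightarrow> 'a set" where
  "Hom C x y = {f \<in> Ar C. Dom C f = x \<and> Cod C f = y}"

locale category =
  fixes C :: "('o, 'a) cat"
  assumes Dom_in: "f \<in> Ar C \<Longrightarrow> Dom C f \<in> Ob C"
    and Cod_in: "f \<in> Ar C \<Longrightarrow> Cod C f \<in> Ob C"
    and Id_in: "x \<in> Ob C \<Longrightarrow> Id C x \<in> Hom C x x"
    and Comp_in: "f \<in> Hom C x y \<Longrightarrow> g \<in> Hom C y z \<Longrightarrow> Comp C g f \<in> Hom C x z"
    and Comp_Id: "f \<in> Hom C x y \<Longrightarrow> Comp C f (Id C x) = f"
    and Id_Comp: "f \<in> Hom C x y \<Longrightarrow> Comp C (Id C y) f = f"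
    and Comp_assoc: "f \<in> Hom C w x \<Longrightarrow> g \<in> Hom C x y \<Longrightarrow> h \<in> Hom C y z
      \<Longrightarrow> Comp C h (Comp C g f) = Comp C (Comp C h g) f"

record ('o1, 'a1, 'o2, 'a2) funct =
  omap :: "'o1 \<Rightarrow> 'o2"
  amap :: "'a1 \<Rightarrow> 'a2"

locale is_functor = source: category C + target: category D
  for C :: "('o1, 'a1) cat" and D :: "('o2, 'a2) cat" +
  fixes F :: "('o1, 'a1, 'o2, 'a2) funct"
  assumes omap_in: "x \<in> Ob C \<Longrightarrow> omap F x \<in> Ob D"
    and amap_in: "f \<in> Hom C x y \<Longrightarrow> amap F f \<in> Hom D (omap F x) (omap F y)"
    and amap_Id: "x \<in> Ob C \<Longrightarrow> amap F (Id C x) = Id D (omap F x)"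
    and amap_Comp: "f \<in> Hom C x y \<Longrightarrow> g \<in> Hom C y z
      \<Longrightarrow> amap F (Comp C g f) = Comp D (amap F g) (amap F f)"

text \<open>Equality of functors with source \<open>C\<close>: the underlying HOL functions carry junk values
  outside of \<open>C\<close>, which must be ignored.\<close>

definition functor_eq :: "('o1, 'a1) cat \<Rightarrow> ('o1, 'a1, 'o2, 'a2) funct
    \<Rightarrow> ('o1, 'a1, 'o2, 'a2) funct \<Rightarrow> bool" where
  "functor_eq C F G \<longleftrightarrow>
    (\<forall>x\<in>Ob C. omap F x = omap G x) \<and> (\<forall>f\<in>Ar C. amap F f = amap G f)"

definition comp_functor :: "('o2, 'a2, 'o3, 'a3) funct \<Rightarrow> ('o1, 'a1, 'o2, 'a2) funct
    \<Rightarrow> ('o1, 'a1, 'o3, 'a3) funct" where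
  "comp_functor G F = \<lparr>omap = omap G \<circ> omap F, amap = amap G \<circ> amap F\<rparr>"

locale nat_trans = source: is_functor C D F + target: is_functor C D G
  for C :: "('o1, 'a1) cat" and D :: "('o2, 'a2) cat"
    and F G :: "('o1, 'a1, 'o2, 'a2) funct" +
  fixes \<alpha> :: "'o1 \<Rightarrow> 'a2"
  assumes component_in: "x \<in> Ob C \<Longrightarrow> \<alpha> x \<in> Hom D (omap F x) (omap G x)"
    and naturality: "f \<in> Hom C x y
      \<Longrightarrow> Comp D (amap G f) (\<alpha> x) = Comp D (\<alpha> y) (amap F f)"

definition op_cat :: "('o, 'a) cat \<Rightarrow> ('o, 'a) cat" where
  "op_cat C = \<lparr>Ob = Ob C, Ar = Ar C, Dom = Cod C, Cod = Dom C, Id = Id C,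
    Comp = (\<lambda>g f. Comp C f g)\<rparr>"

definition prod_cat :: "('o1, 'a1) cat \<Rightarrow> ('o2, 'a2) cat \<Rightarrow> ('o1 \<times> 'o2, 'a1 \<times> 'a2) cat" where
  "prod_cat C D = \<lparr>Ob = Ob C \<times> Ob D, Ar = Ar C \<times> Ar D,
    Dom = map_prod (Dom C) (Dom D), Cod = map_prod (Cod C) (Cod D),
    Id = map_prod (Id C) (Id D),
    Comp = (\<lambda>(g, g') (f, f'). (Comp C g f, Comp D g' f'))\<rparr>"

text \<open>The walking arrow is the poset \<open>False \<le> True\<close>; \<open>False\<close> plays the role of the object 0
  and \<open>True\<close> that of 1, and an arrow is the pair of its source and target.\<close>

definition walking_arrow :: "(bool, bool \<times> bool) cat" where
  "walking_arrow = \<lparr>Ob = UNIV, Ar = {(x, y). x \<le> y}, Dom = fst, Cod = snd,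
    Id = (\<lambda>x. (x, x)), Comp = (\<lambda>g f. (fst f, snd g))\<rparr>"

definition inclusion :: "bool
    \<Rightarrow> ('o, 'a, 'o \<times> bool, 'a \<times> (bool \<times> bool)) funct" where
  "inclusion \<epsilon> = \<lparr>omap = (\<lambda>c. (c, \<epsilon>)), amap = (\<lambda>f. (f, Id walking_arrow \<epsilon>))\<rparr>"

lemma category_op_cat: "category C \<Longrightarrow> category (op_cat C)"
  by (simp add: category_def op_cat_def Hom_def)

lemma category_prod_cat: "category C \<Longrightarrow> category D \<Longrightarrow> category (prod_cat C D)"
  by (auto simp: category_def prod_cat_def Hom_def)

lemma category_walking_arrow: "category walking_arrow"
  by unfold_locales (auto simp: walking_arrow_def Hom_def)

lemma is_functor_inclusion:
  "category C \<Longrightarrow> is_functor C (prod_cat C walking_arrow) (inclusion \<epsilon>)"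
  using category_prod_cat[OF _ category_walking_arrow, of C]
  by (auto simp: is_functor_def is_functor_axioms_def inclusion_def prod_cat_def
      walking_arrow_def Hom_def)

definition directed_lifting :: "bool \<Rightarrow> ('co, 'ca) cat \<Rightarrow> ('eo, 'ea) cat \<Rightarrow> ('bo, 'ba) cat
    \<Rightarrow> ('eo, 'ea, 'bo, 'ba) funct \<Rightarrow> bool" where
  "directed_lifting \<epsilon> C E B P \<longleftrightarrow>
    (\<forall>F H. is_functor C E F \<longrightarrow> is_functor (prod_cat C walking_arrow) B H
      \<longrightarrow> functor_eq C (comp_functor H (inclusion \<epsilon>)) (comp_functor P F)
      \<longrightarrow> (\<exists>H'. is_functor (prod_cat C walking_arrow) E H'
            \<and> functor_eq (prod_cat C walking_arrow) (comp_functor P H') H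
            \<and> functor_eq C (comp_functor H' (inclusion \<epsilon>)) F))"

text \<open>HOL cannot quantify over types inside a formula, so the types that carry the test
  category \<open>C\<close> are a parameter of the following two notions. The quantification over all
  small categories is the one over this parameter together with the one over \<open>C\<close>: as a
  conclusion, the property has to be proved for arbitrary type variables; as a hypothesis, a lifting property for the
  categories over one pair of types is weaker than the one for all small categories.\<close>

definition right_directed_fibration :: "('co \<times> 'ca) itself \<Rightarrow> ('eo, 'ea) cat
    \<Rightarrow> ('bo, 'ba) cat \<Rightarrow> ('eo, 'ea, 'bo, 'ba) funct \<Rightarrow> bool" where
  "right_directed_fibration T E B P \<longleftrightarrow>
    (\<forall>C :: ('co, 'ca) cat. category C \<longrightarrow> directed_lifting False C E B P)"

definition left_directed_fibration :: "('co \<times> 'ca) itself \<Rightarrow> ('eo, 'ea) cat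
    \<Rightarrow> ('bo, 'ba) cat \<Rightarrow> ('eo, 'ea, 'bo, 'ba) funct \<Rightarrow> bool" where
  "left_directed_fibration T E B P \<longleftrightarrow>
    (\<forall>C :: ('co, 'ca) cat. category C \<longrightarrow> directed_lifting True C E B P)"

definition opcartesian :: "('eo, 'ea) cat \<Rightarrow> ('bo, 'ba) cat
    \<Rightarrow> ('eo, 'ea, 'bo, 'ba) funct \<Rightarrow> 'ea \<Rightarrow> bool" where
  "opcartesian E B P \<phi> \<longleftrightarrow> \<phi> \<in> Ar E \<and>
    (\<forall>e\<in>Ob E. \<forall>\<beta>\<in>Hom E (Dom E \<phi>) e. \<forall>a\<in>Hom B (omap P (Cod E \<phi>)) (omap P e).
      Comp B a (amap P \<phi>) = amap P \<beta> \<longrightarrow>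
      (\<exists>!\<alpha>. \<alpha> \<in> Hom E (Cod E \<phi>) e \<and> Comp E \<alpha> \<phi> = \<beta> \<and> amap P \<alpha> = a))"

definition grothendieck_opfibration :: "('eo, 'ea) cat \<Rightarrow> ('bo, 'ba) cat
    \<Rightarrow> ('eo, 'ea, 'bo, 'ba) funct \<Rightarrow> bool" where
  "grothendieck_opfibration E B P \<longleftrightarrow>
    (\<forall>b1\<in>Ob B. \<forall>b2\<in>Ob B. \<forall>f\<in>Hom B b1 b2. \<forall>e1\<in>Ob E. omap P e1 = b1 \<longrightarrow>
      (\<exists>e2\<in>Ob E. \<exists>\<phi>\<in>Hom E e1 e2. opcartesian E B P \<phi> \<and> amap P \<phi> = f))"

text \<open>The opposite functor has the same object and arrow maps as \<open>P\<close>.\<close>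

definition grothendieck_fibration :: "('eo, 'ea) cat \<Rightarrow> ('bo, 'ba) cat
    \<Rightarrow> ('eo, 'ea, 'bo, 'ba) funct \<Rightarrow> bool" where
  "grothendieck_fibration E B P \<longleftrightarrow> grothendieck_opfibration (op_cat E) (op_cat B) P"

end

theory Submission imports Defs begin

text \<open>A functor \<open>H\<close> on \<open>C \<times> I\<close> is the same as a natural transformation between its restrictions
  to the two ends, the value of \<open>H\<close> at \<open>(f, 0 \<rightarrow> 1)\<close> being the diagonal of the naturality square
  of \<open>f\<close>. So it suffices to lift natural transformations: choose opcartesian lifts of the
  components; their universal property supplies the arrow map of the lifted target functor, and
  its uniqueness part gives functoriality. The dual statement follows by reversing both \<open>C\<close> and
  the walking arrow. For the converse, lift along the one-object, one-arrow category.\<close>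

section \<open>Hom-sets, composite functors and opposite categories\<close>

lemma (in category) HomI: "f \<in> Ar C \<Longrightarrow> f \<in> Hom C (Dom C f) (Cod C f)"
  by (simp add: Hom_def)

lemma (in category) Hom_ends:
  assumes "f \<in> Hom C x y"
  shows "x \<in> Ob C" "y \<in> Ob C"
  using assms Dom_in Cod_in by (auto simp: Hom_def)

lemma HomD:
  assumes "f \<in> Hom C x y"
  shows "f \<in> Ar C" "Dom C f = x" "Cod C f = y"
  using assms by (auto simp: Hom_def)

lemma is_functor_comp_functor:
  assumes "is_functor C D F" "is_functor D E G"
  shows "is_functor C E (comp_functor G F)"
proof -
  interpret F: is_functor C D F by fact
  interpret G: is_functor D E G by fact
  show ?thesis
    by unfold_locales (auto simp: comp_functor_def F.omap_in G.omap_in F.amap_in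
      F.amap_Id G.amap_Id F.amap_Comp G.amap_Comp[OF F.amap_in F.amap_in] intro!: G.amap_in)
qed

lemma Hom_op_cat [simp]: "Hom (op_cat C) x y = Hom C y x"
  by (auto simp: Hom_def op_cat_def)

lemma op_cat_op_cat [simp]: "op_cat (op_cat C) = C"
  by (simp add: op_cat_def)

lemma is_functor_op_cat:
  assumes "is_functor C D F"
  shows "is_functor (op_cat C) (op_cat D) F"
proof -
  interpret F: is_functor C D F by fact
  show ?thesis
    unfolding is_functor_def is_functor_axioms_def Hom_op_cat
    using F.omap_in F.amap_in F.amap_Id F.amap_Comp
      category_op_cat[OF F.source.category_axioms] category_op_cat[OF F.target.category_axioms]
    by (auto simp: op_cat_def)
qed

section \<open>Cylinders \<open>C \<times> I\<close> and natural transformations\<close>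

lemma Hom_prod_walking_arrow:
  "h \<in> Hom (prod_cat C walking_arrow) (x, a) (y, b) \<longleftrightarrow>
    (\<exists>f. h = (f, (a, b)) \<and> f \<in> Hom C x y \<and> a \<le> b)"
  by (auto simp: Hom_def prod_cat_def walking_arrow_def)

lemma Comp_prod_walking_arrow:
  "Comp (prod_cat C walking_arrow) (g, (b', c)) (f, (a, b)) = (Comp C g f, (a, c))"
  by (simp add: prod_cat_def walking_arrow_def)

lemma Id_prod_walking_arrow: "Id (prod_cat C walking_arrow) (x, a) = (Id C x, (a, a))"
  by (simp add: prod_cat_def walking_arrow_def)

lemma Ob_prod_walking_arrow: "(x, a) \<in> Ob (prod_cat C walking_arrow) \<longleftrightarrow> x \<in> Ob C"
  by (simp add: prod_cat_def walking_arrow_def)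

lemma Ar_prod_walking_arrow:
  "(f, (a, b)) \<in> Ar (prod_cat C walking_arrow) \<longleftrightarrow> f \<in> Ar C \<and> a \<le> b"
  by (simp add: prod_cat_def walking_arrow_def)

lemmas prod_walking_arrow_simps = Hom_prod_walking_arrow Comp_prod_walking_arrow
  Id_prod_walking_arrow Ob_prod_walking_arrow Ar_prod_walking_arrow

text \<open>Of the two equal composites around a naturality square, the one through \<open>F\<close>
  serves as the diagonal. On an arrow of the walking arrow \<open>a\<close> implies
  \<open>b\<close>, so the branch for \<open>a\<close> does not test \<open>b\<close>.\<close>

definition cylinder_functor :: "('o1, 'a1) cat \<Rightarrow> ('o2, 'a2) cat
    \<Rightarrow> ('o1, 'a1, 'o2, 'a2) funct \<Rightarrow> ('o1, 'a1, 'o2, 'a2) funct \<Rightarrow> ('o1 \<Rightarrow> 'a2)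
    \<Rightarrow> ('o1 \<times> bool, 'a1 \<times> (bool \<times> bool), 'o2, 'a2) funct" where
  "cylinder_functor C D F G \<alpha> =
    \<lparr>omap = (\<lambda>(x, a). if a then omap G x else omap F x),
     amap = (\<lambda>(f, (a, b)). if a then amap G f
       else if b then Comp D (\<alpha> (Cod C f)) (amap F f) else amap F f)\<rparr>"

text \<open>Two composable arrows pass through levels \<open>a \<le> b \<le> c\<close>. If the level
  is constant, functoriality of \<open>F\<close> or \<open>G\<close> applies; otherwise exactly one
  of the two arrows crosses from end 0 to end 1.\<close>

lemma (in nat_trans) is_functor_cylinder_functor:
  "is_functor (prod_cat C walking_arrow) D (cylinder_functor C D F G \<alpha>)"
proof -
  let ?H = "cylinder_functor C D F G \<alpha>"
  interpret prod: category "prod_cat C walking_arrow"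
    by (rule category_prod_cat[OF source.source.category_axioms category_walking_arrow])
  show ?thesis
  proof unfold_locales
    fix p assume "p \<in> Ob (prod_cat C walking_arrow)"
    then show "omap ?H p \<in> Ob D"
      by (cases p) (auto simp: cylinder_functor_def prod_walking_arrow_simps
        source.omap_in target.omap_in)
  next
    fix h p q assume h: "h \<in> Hom (prod_cat C walking_arrow) p q"
    obtain x a where p: "p = (x, a)" by fastforce
    obtain y b where q: "q = (y, b)" by fastforce
    obtain f where "h = (f, (a, b))" and f: "f \<in> Hom C x y" and "a \<le> b"
      using h by (auto simp: p q prod_walking_arrow_simps)
    moreover have "y \<in> Ob C" using f by (rule source.source.Hom_ends)
    moreover have "Comp D (\<alpha> y) (amap F f) \<in> Hom D (omap F x) (omap G y)"
      using source.amap_in[OF f] component_in[OF \<open>y \<in> Ob C\<close>] by (rule source.target.Comp_in)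
    ultimately show "amap ?H h \<in> Hom D (omap ?H p) (omap ?H q)"
      by (auto simp: p q cylinder_functor_def HomD[OF f] source.amap_in target.amap_in)
  next
    fix p assume "p \<in> Ob (prod_cat C walking_arrow)"
    then show "amap ?H (Id (prod_cat C walking_arrow) p) = Id D (omap ?H p)"
      by (cases p) (auto simp: cylinder_functor_def prod_walking_arrow_simps
        source.amap_Id target.amap_Id)
  next
    fix h k p q r
    assume h: "h \<in> Hom (prod_cat C walking_arrow) p q"
      and k: "k \<in> Hom (prod_cat C walking_arrow) q r"
    obtain x a where p: "p = (x, a)" by fastforce
    obtain y b where q: "q = (y, b)" by fastforce
    obtain z c where r: "r = (z, c)" by fastforce
    obtain f where h': "h = (f, (a, b))" and f: "f \<in> Hom C x y" and "a \<le> b"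
      using h by (auto simp: p q prod_walking_arrow_simps)
    obtain g where k': "k = (g, (b, c))" and g: "g \<in> Hom C y z" and "b \<le> c"
      using k by (auto simp: q r prod_walking_arrow_simps)
    have gf: "Comp C g f \<in> Hom C x z" using f g by (rule source.source.Comp_in)
    have y: "y \<in> Ob C" and z: "z \<in> Ob C" using source.source.Hom_ends[OF g] by auto
    \<comment> \<open>The second arrow crosses: associativity and functoriality of \<open>F\<close>
      suffice.\<close>
    have lower: "Comp D (\<alpha> z) (amap F (Comp C g f))
        = Comp D (Comp D (\<alpha> z) (amap F g)) (amap F f)"
      using source.target.Comp_assoc[OF source.amap_in[OF f] source.amap_in[OF g]
          component_in[OF z]] source.amap_Comp[OF f g] by simp
    \<comment> \<open>The first arrow crosses: naturality at \<open>g\<close> moves the crossing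
      past \<open>g\<close>.\<close>
    have upper: "Comp D (amap G g) (Comp D (\<alpha> y) (amap F f))
        = Comp D (\<alpha> z) (amap F (Comp C g f))"
      using source.target.Comp_assoc[OF source.amap_in[OF f] component_in[OF y]
          target.amap_in[OF g]] naturality[OF g] lower by simp
    show "amap ?H (Comp (prod_cat C walking_arrow) k h) = Comp D (amap ?H k) (amap ?H h)"
      using \<open>a \<le> b\<close> \<open>b \<le> c\<close> lower upper
      by (auto simp: h' k' Comp_prod_walking_arrow cylinder_functor_def HomD[OF f] HomD[OF g]
        HomD[OF gf] source.amap_Comp[OF f g] target.amap_Comp[OF f g])
  qed
qed

text \<open>The arrow \<open>(f, 0 -> 1)\<close> of the cylinder factors both as the crossing at
  \<open>x\<close> followed by \<open>f\<close> at end 1, and as \<open>f\<close> at end 0 followed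
  by the crossing at \<open>y\<close>. Applying \<open>H\<close> to both factorisations gives the
  naturality square.\<close>

lemma nat_trans_ends:
  assumes C: "category C" and H: "is_functor (prod_cat C walking_arrow) B H"
  shows "nat_trans C B (comp_functor H (inclusion False)) (comp_functor H (inclusion True))
    (\<lambda>c. amap H (Id C c, (False, True)))"
proof -
  interpret C: category C by fact
  interpret H: is_functor "prod_cat C walking_arrow" B H by fact
  interpret F: is_functor C B "comp_functor H (inclusion False)"
    by (rule is_functor_comp_functor[OF is_functor_inclusion[OF C] H])
  interpret G: is_functor C B "comp_functor H (inclusion True)"
    by (rule is_functor_comp_functor[OF is_functor_inclusion[OF C] H])
  show ?thesis
  proof unfold_locales
    fix x assume "x \<in> Ob C"
    then show "amap H (Id C x, (False, True)) \<in> Hom B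
        (omap (comp_functor H (inclusion False)) x) (omap (comp_functor H (inclusion True)) x)"
      by (auto simp: comp_functor_def inclusion_def prod_walking_arrow_simps C.Id_in
        intro!: H.amap_in)
  next
    fix f x y assume f: "f \<in> Hom C x y"
    note xy = C.Hom_ends[OF f]
    have "Comp B (amap H (f, (True, True))) (amap H (Id C x, (False, True)))
        = amap H (f, (False, True))"
      using H.amap_Comp[of "(Id C x, (False, True))" "(x, False)" "(x, True)"
          "(f, (True, True))" "(y, True)"] f xy
      by (simp add: prod_walking_arrow_simps C.Id_in C.Comp_Id)
    moreover have "Comp B (amap H (Id C y, (False, True))) (amap H (f, (False, False)))
        = amap H (f, (False, True))"
      using H.amap_Comp[of "(f, (False, False))" "(x, False)" "(y, False)"
          "(Id C y, (False, True))" "(y, True)"] f xy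
      by (simp add: prod_walking_arrow_simps C.Id_in C.Id_Comp)
    ultimately show "Comp B (amap (comp_functor H (inclusion True)) f)
          (amap H (Id C x, (False, True)))
        = Comp B (amap H (Id C y, (False, True))) (amap (comp_functor H (inclusion False)) f)"
      by (simp add: comp_functor_def inclusion_def walking_arrow_def)
  qed
qed

section \<open>Lifting along an opfibration\<close>

text \<open>The arrow \<open>G f\<close> is defined as the unique filler of the naturality square of
  \<open>f\<close> lying over \<open>G' f\<close>, so naturality of the lift and the equation for
  \<open>P G\<close> on arrows are built in.\<close>

lemma nat_trans_lift:
  fixes E :: "('eo, 'ea) cat" and C :: "('co, 'ca) cat"
  assumes P: "is_functor E B P" and opfib: "grothendieck_opfibration E B P"
    and \<alpha>': "nat_trans C B F' G' \<alpha>'" and F: "is_functor C E F"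
    and PF: "functor_eq C (comp_functor P F) F'"
  obtains G \<alpha> where "nat_trans C E F G \<alpha>" "functor_eq C (comp_functor P G) G'"
    "\<And>c. c \<in> Ob C \<Longrightarrow> amap P (\<alpha> c) = \<alpha>' c"
proof -
  interpret P: is_functor E B P by fact
  interpret F: is_functor C E F by fact
  interpret n: nat_trans C B F' G' \<alpha>' by fact
  have PFo: "omap P (omap F x) = omap F' x" if "x \<in> Ob C" for x
    using PF that by (simp add: functor_eq_def comp_functor_def)
  have PFa: "amap P (amap F f) = amap F' f" if "f \<in> Hom C x y" for f x y
    using PF HomD[OF that] by (simp add: functor_eq_def comp_functor_def)
  have "\<exists>e \<phi>. \<phi> \<in> Hom E (omap F c) e \<and> opcartesian E B P \<phi> \<and> amap P \<phi> = \<alpha>' c"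
    if c: "c \<in> Ob C" for c
    using opfib c n.component_in[OF c] PFo[OF c] n.source.omap_in[OF c] n.target.omap_in[OF c]
      F.omap_in[OF c]
    unfolding grothendieck_opfibration_def by metis
  \<comment> \<open>The axiom of choice fixes one lift per object; the codomains \<open>e c\<close>
    will be the objects \<open>G c\<close>.\<close>
  then obtain e \<phi> where \<phi>: "\<And>c. c \<in> Ob C \<Longrightarrow> \<phi> c \<in> Hom E (omap F c) (e c)"
    and opc: "\<And>c. c \<in> Ob C \<Longrightarrow> opcartesian E B P (\<phi> c)"
    and P\<phi>: "\<And>c. c \<in> Ob C \<Longrightarrow> amap P (\<phi> c) = \<alpha>' c"
    by metis
  have e: "e c \<in> Ob E" if "c \<in> Ob C" for c
    using \<phi>[OF that] by (rule P.source.Hom_ends)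
  \<comment> \<open>Both sides are the codomain of \<open>amap P (\<phi> c)\<close>, which is
    \<open>\<alpha>' c\<close>.\<close>
  have Pe: "omap P (e c) = omap G' c" if "c \<in> Ob C" for c
    using HomD[OF P.amap_in[OF \<phi>[OF that]]] HomD[OF n.component_in[OF that]] P\<phi>[OF that] by simp
  define lifts where "lifts f x y \<gamma> \<longleftrightarrow> \<gamma> \<in> Hom E (e x) (e y)
    \<and> Comp E \<gamma> (\<phi> x) = Comp E (\<phi> y) (amap F f) \<and> amap P \<gamma> = amap G' f" for f x y \<gamma>
  have unique_lift: "\<exists>!\<gamma>. lifts f x y \<gamma>" if f: "f \<in> Hom C x y" for f x y
  proof -
    note x = F.source.Hom_ends(1)[OF f] and y = F.source.Hom_ends(2)[OF f]
    have \<beta>: "Comp E (\<phi> y) (amap F f) \<in> Hom E (omap F x) (e y)"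
      using F.amap_in[OF f] \<phi>[OF y] by (rule P.source.Comp_in)
    \<comment> \<open>By naturality of \<open>\<alpha>'\<close>, the image of the arrow to be
      factored already factors through \<open>amap P (\<phi> x)\<close> by \<open>amap G' f\<close>.
      This is the premise of the universal property of \<open>\<phi> x\<close>.\<close>
    have "amap P (Comp E (\<phi> y) (amap F f)) = Comp B (amap G' f) (amap P (\<phi> x))"
      using P.amap_Comp[OF F.amap_in[OF f] \<phi>[OF y]] n.naturality[OF f] P\<phi>[OF x] P\<phi>[OF y]
        PFa[OF f] by simp
    moreover have "amap G' f \<in> Hom B (omap P (e x)) (omap P (e y))"
      using n.target.amap_in[OF f] Pe x y by simp
    ultimately show ?thesis
      using opc[OF x] \<beta> e[OF y] HomD[OF \<phi>[OF x]] unfolding opcartesian_def lifts_def by simp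
  qed
  define G where "G = \<lparr>omap = e, amap = (\<lambda>f. THE \<gamma>. lifts f (Dom C f) (Cod C f) \<gamma>)\<rparr>"
  have G_lifts: "lifts f x y (amap G f)" if f: "f \<in> Hom C x y" for f x y
    using theI'[OF unique_lift[OF f]] HomD[OF f] by (simp add: G_def)
  \<comment> \<open>Each functor law for \<open>G\<close> is reduced to checking that its right-hand
    side is also a lift.\<close>
  have G_eqI: "amap G f = \<gamma>" if "f \<in> Hom C x y" "lifts f x y \<gamma>" for f x y \<gamma>
    using unique_lift G_lifts that by blast
  have Go: "omap G = e" by (simp add: G_def)
  interpret G: is_functor C E G
  proof unfold_locales
    show "omap G x \<in> Ob E" if "x \<in> Ob C" for x using e[OF that] by (simp add: Go)
    show "amap G f \<in> Hom E (omap G x) (omap G y)" if "f \<in> Hom C x y" for f x y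
      using G_lifts[OF that] by (simp add: Go lifts_def)
    show "amap G (Id C x) = Id E (omap G x)" if x: "x \<in> Ob C" for x
      using x e[OF x] P.source.Id_in[OF e[OF x]] \<phi>[OF x]
      by (intro G_eqI[OF F.source.Id_in[OF x]])
        (simp add: Go lifts_def P.amap_Id Pe n.target.amap_Id F.amap_Id P.source.Id_Comp
          P.source.Comp_Id)
  next
    fix f x y g z assume f: "f \<in> Hom C x y" and g: "g \<in> Hom C y z"
    note x = F.source.Hom_ends(1)[OF f] and y = F.source.Hom_ends(2)[OF f]
      and z = F.source.Hom_ends(2)[OF g]
    have Gf: "amap G f \<in> Hom E (e x) (e y)"
      "Comp E (amap G f) (\<phi> x) = Comp E (\<phi> y) (amap F f)" "amap P (amap G f) = amap G' f"
      using G_lifts[OF f] by (auto simp: lifts_def)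
    have Gg: "amap G g \<in> Hom E (e y) (e z)"
      "Comp E (amap G g) (\<phi> y) = Comp E (\<phi> z) (amap F g)" "amap P (amap G g) = amap G' g"
      using G_lifts[OF g] by (auto simp: lifts_def)
    \<comment> \<open>Pasting the filled squares of \<open>f\<close> and \<open>g\<close> fills the
      square of their composite.\<close>
    have "Comp E (Comp E (amap G g) (amap G f)) (\<phi> x)
        = Comp E (amap G g) (Comp E (\<phi> y) (amap F f))"
      using P.source.Comp_assoc[OF \<phi>[OF x] Gf(1) Gg(1)] Gf(2) by simp
    also have "\<dots> = Comp E (Comp E (\<phi> z) (amap F g)) (amap F f)"
      using P.source.Comp_assoc[OF F.amap_in[OF f] \<phi>[OF y] Gg(1)] Gg(2) by simp
    also have "\<dots> = Comp E (\<phi> z) (amap F (Comp C g f))"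
      using P.source.Comp_assoc[OF F.amap_in[OF f] F.amap_in[OF g] \<phi>[OF z]]
        F.amap_Comp[OF f g] by simp
    finally have "lifts (Comp C g f) x z (Comp E (amap G g) (amap G f))"
      using P.source.Comp_in[OF Gf(1) Gg(1)] P.amap_Comp[OF Gf(1) Gg(1)] Gf(3) Gg(3)
        n.target.amap_Comp[OF f g] by (simp add: lifts_def)
    then show "amap G (Comp C g f) = Comp E (amap G g) (amap G f)"
      using F.source.Comp_in[OF f g] by (intro G_eqI)
  qed
  have "nat_trans C E F G \<phi>"
    using \<phi> G_lifts by unfold_locales (simp_all add: Go lifts_def)
  moreover have "functor_eq C (comp_functor P G) G'"
    using Pe G_lifts[OF F.source.HomI]
    by (auto simp: functor_eq_def comp_functor_def Go lifts_def)
  ultimately show thesis using P\<phi> that by blast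
qed

text \<open>The cylinder of the lifted transformation is the required functor. Its image under
  \<open>P\<close> has the same ends and crossings as \<open>H\<close>, and these determine a
  functor on the cylinder.\<close>

lemma directed_lifting_False_if_opfibration:
  assumes P: "is_functor E B P" and opfib: "grothendieck_opfibration E B P" and C: "category C"
  shows "directed_lifting False C E B P"
  unfolding directed_lifting_def
proof (intro allI impI)
  fix F H
  assume F: "is_functor C E F" and H: "is_functor (prod_cat C walking_arrow) B H"
    and HF: "functor_eq C (comp_functor H (inclusion False)) (comp_functor P F)"
  interpret P: is_functor E B P by fact
  interpret F: is_functor C E F by fact
  interpret H: is_functor "prod_cat C walking_arrow" B H by fact
  have "functor_eq C (comp_functor P F) (comp_functor H (inclusion False))"
    using HF by (simp add: functor_eq_def)
  from nat_trans_lift[OF P opfib nat_trans_ends[OF C H] F this]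
  obtain G \<alpha> where "nat_trans C E F G \<alpha>"
    and PG: "functor_eq C (comp_functor P G) (comp_functor H (inclusion True))"
    and P\<alpha>: "\<And>c. c \<in> Ob C \<Longrightarrow> amap P (\<alpha> c) = amap H (Id C c, (False, True))" by metis
  interpret \<alpha>: nat_trans C E F G \<alpha> by fact
  let ?H = "cylinder_functor C E F G \<alpha>"
  have "amap P (amap ?H (f, (a, b))) = amap H (f, (a, b))" if f: "f \<in> Ar C" and ab: "a \<le> b" for f a b
  \<comment> \<open>The case condition singles out the arrows that cross; since
    \<open>a \<le> b\<close>, the others lie in one end, where \<open>HF\<close> or
    \<open>PG\<close> decides.\<close>
  proof (cases "\<not> a \<and> b")
    case False
    then show ?thesis
      using f ab HF PG
      by (auto simp: cylinder_functor_def functor_eq_def comp_functor_def inclusion_def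
        walking_arrow_def)
  next
    case True
    note f' = F.source.HomI[OF f]
    have y: "Cod C f \<in> Ob C" using f by (rule F.source.Cod_in)
    have "amap P (amap ?H (f, (a, b)))
        = Comp B (amap H (Id C (Cod C f), (False, True))) (amap H (f, (False, False)))"
      using True f HF P\<alpha>[OF y] P.amap_Comp[OF F.amap_in[OF f'] \<alpha>.component_in[OF y]]
      by (simp add: cylinder_functor_def functor_eq_def comp_functor_def inclusion_def
        walking_arrow_def)
    \<comment> \<open>\<open>H\<close> preserves the factorisation of \<open>(f, 0 -> 1)\<close>
      through the crossing at the codomain of \<open>f\<close>.\<close>
    also have "\<dots> = amap H (f, (False, True))"
      using H.amap_Comp[of "(f, (False, False))" "(Dom C f, False)" "(Cod C f, False)"
          "(Id C (Cod C f), (False, True))" "(Cod C f, True)"] f' y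
      by (simp add: prod_walking_arrow_simps F.source.Id_in F.source.Id_Comp)
    finally show ?thesis using True by simp
  qed
  moreover have "omap P (omap ?H (x, a)) = omap H (x, a)" if "x \<in> Ob C" for x a
    using that HF PG
    by (auto simp: cylinder_functor_def functor_eq_def comp_functor_def inclusion_def)
  ultimately have "functor_eq (prod_cat C walking_arrow) (comp_functor P ?H) H"
    unfolding functor_eq_def comp_functor_def by (auto simp: prod_walking_arrow_simps)
  moreover have "functor_eq C (comp_functor ?H (inclusion False)) F"
    by (simp add: functor_eq_def comp_functor_def inclusion_def cylinder_functor_def
      walking_arrow_def)
  ultimately show "\<exists>H'. is_functor (prod_cat C walking_arrow) E H'
      \<and> functor_eq (prod_cat C walking_arrow) (comp_functor P H') H
      \<and> functor_eq C (comp_functor H' (inclusion False)) F"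
    using \<alpha>.is_functor_cylinder_functor by blast
qed

section \<open>Duality\<close>

text \<open>The walking arrow is isomorphic to its own opposite by exchanging the ends; this is the
  induced identification of the cylinder on the opposite of \<open>C\<close> with the opposite of
  the cylinder on \<open>C\<close>. Since \<open>op_cat\<close> keeps the carriers, the same maps
  serve in both directions, and they are their own inverses.\<close>

definition reversal :: "('o \<times> bool, 'a \<times> (bool \<times> bool), 'o \<times> bool, 'a \<times> (bool \<times> bool)) funct" where
  "reversal = \<lparr>omap = map_prod id Not, amap = map_prod id (\<lambda>(a, b). (\<not> b, \<not> a))\<rparr>"

lemma is_functor_reversal:
  assumes "category C"
  shows "is_functor (prod_cat (op_cat C) walking_arrow) (op_cat (prod_cat C walking_arrow)) reversal"
  using category_op_cat[OF category_prod_cat[OF assms category_walking_arrow]]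
    category_prod_cat[OF category_op_cat[OF assms] category_walking_arrow]
  by (auto simp: is_functor_def is_functor_axioms_def reversal_def prod_cat_def op_cat_def
    walking_arrow_def Hom_def)

text \<open>Precomposing \<open>H\<close> with \<open>reversal\<close> turns its end 1 into end 0
  over the opposite of \<open>C\<close>. A lift \<open>K\<close> of this problem is carried back by
  a second reversal.\<close>

lemma directed_lifting_op_cat:
  fixes E :: "('eo, 'ea) cat" and B :: "('bo, 'ba) cat" and C :: "('co, 'ca) cat"
  assumes C: "category C"
    and lift: "directed_lifting False (op_cat C) (op_cat E) (op_cat B) P"
  shows "directed_lifting True C E B P"
  unfolding directed_lifting_def
proof (intro allI impI)
  fix F H
  assume F: "is_functor C E F" and H: "is_functor (prod_cat C walking_arrow) B H"
    and HF: "functor_eq C (comp_functor H (inclusion True)) (comp_functor P F)"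
  have "is_functor (prod_cat (op_cat C) walking_arrow) (op_cat B) (comp_functor H reversal)"
    using is_functor_comp_functor[OF is_functor_reversal[OF C] is_functor_op_cat[OF H]] .
  moreover have "functor_eq (op_cat C)
      (comp_functor (comp_functor H reversal) (inclusion False)) (comp_functor P F)"
    using HF by (simp add: functor_eq_def comp_functor_def inclusion_def reversal_def
      walking_arrow_def op_cat_def)
  ultimately obtain K where K: "is_functor (prod_cat (op_cat C) walking_arrow) (op_cat E) K"
    and PK: "functor_eq (prod_cat (op_cat C) walking_arrow) (comp_functor P K)
      (comp_functor H reversal)"
    and KF: "functor_eq (op_cat C) (comp_functor K (inclusion False)) F"
    using lift is_functor_op_cat[OF F] unfolding directed_lifting_def by metis
  have "is_functor (prod_cat C walking_arrow) E (comp_functor K reversal)"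
    \<comment> \<open>Here \<open>reversal\<close> is taken for \<open>op_cat C\<close>, and the
      double opposites of \<open>C\<close> and \<open>E\<close> cancel.\<close>
    using is_functor_comp_functor[OF is_functor_reversal[OF category_op_cat[OF C]]
        is_functor_op_cat[OF K]] by simp
  moreover have "functor_eq (prod_cat C walking_arrow)
      (comp_functor P (comp_functor K reversal)) H"
    using PK by (auto simp: functor_eq_def comp_functor_def reversal_def walking_arrow_def
      op_cat_def prod_cat_def)
  moreover have "functor_eq C (comp_functor (comp_functor K reversal) (inclusion True)) F"
    using KF by (simp add: functor_eq_def comp_functor_def inclusion_def reversal_def
      walking_arrow_def op_cat_def)
  ultimately show "\<exists>H'. is_functor (prod_cat C walking_arrow) E H'
      \<and> functor_eq (prod_cat C walking_arrow) (comp_functor P H') H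
      \<and> functor_eq C (comp_functor H' (inclusion True)) F"
    by blast
qed

section \<open>The converse, by lifting over a point\<close>

text \<open>The terminal category, with its object and arrow as parameters so that it exists over
  any pair of carrier types.\<close>

definition point_cat :: "'o \<Rightarrow> 'a \<Rightarrow> ('o, 'a) cat" where
  "point_cat x i = \<lparr>Ob = {x}, Ar = {i}, Dom = (\<lambda>_. x), Cod = (\<lambda>_. x), Id = (\<lambda>_. i),
    Comp = (\<lambda>_ _. i)\<rparr>"

definition point_functor :: "('o2, 'a2) cat \<Rightarrow> 'o2 \<Rightarrow> ('o1, 'a1, 'o2, 'a2) funct" where
  "point_functor D d = \<lparr>omap = (\<lambda>_. d), amap = (\<lambda>_. Id D d)\<rparr>"

lemma category_point_cat: "category (point_cat x i)"
  by (simp add: category_def point_cat_def Hom_def)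

lemma is_functor_point_functor:
  assumes "category D" "d \<in> Ob D"
  shows "is_functor (point_cat x i) D (point_functor D d)"
proof -
  interpret D: category D by fact
  interpret pt: category "point_cat x i" by (rule category_point_cat)
  show ?thesis
    using D.Id_in[OF assms(2)] D.Id_Comp[OF D.Id_in[OF assms(2)]] assms(2)
    by unfold_locales (auto simp: point_functor_def)
qed

text \<open>Turns an arrow into a transformation over the point; naturality amounts to the two unit
  laws.\<close>

lemma nat_trans_point_functor:
  assumes "category D" "f \<in> Hom D d d'"
  shows "nat_trans (point_cat x i) D (point_functor D d) (point_functor D d') (\<lambda>_. f)"
proof -
  interpret D: category D by fact
  interpret F: is_functor "point_cat x i" D "point_functor D d"
    by (rule is_functor_point_functor[OF assms(1) D.Hom_ends(1)[OF assms(2)]])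
  interpret G: is_functor "point_cat x i" D "point_functor D d'"
    by (rule is_functor_point_functor[OF assms(1) D.Hom_ends(2)[OF assms(2)]])
  show ?thesis
    using assms(2) D.Id_Comp[OF assms(2)] D.Comp_Id[OF assms(2)]
    by unfold_locales (auto simp: point_functor_def)
qed

text \<open>A lifting problem over the point consists of an arrow of \<open>B\<close> and an object
  over its source. The single component of a solution is the opcartesian arrow sought.\<close>

lemma opfibration_if_opcartesian_lifts:
  fixes E :: "('eo, 'ea) cat" and B :: "('bo, 'ba) cat"
  assumes P: "is_functor E B P"
    and lift: "\<And>F' G' \<alpha>' F. \<lbrakk>nat_trans (point_cat x i) B F' G' \<alpha>';
      is_functor (point_cat x i) E F; functor_eq (point_cat x i) (comp_functor P F) F'\<rbrakk>
      \<Longrightarrow> \<exists>G \<alpha>. nat_trans (point_cat x i) E F G \<alpha> \<and> amap P (\<alpha> x) = \<alpha>' x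
        \<and> opcartesian E B P (\<alpha> x)"
  shows "grothendieck_opfibration E B P"
  unfolding grothendieck_opfibration_def
proof (intro ballI impI)
  fix b1 b2 f e1
  assume f: "f \<in> Hom B b1 b2" and e1: "e1 \<in> Ob E" and Pe1: "omap P e1 = b1"
  interpret P: is_functor E B P by fact
  have "functor_eq (point_cat x i) (comp_functor P (point_functor E e1)) (point_functor B b1)"
    using P.amap_Id[OF e1] Pe1 by (simp add: functor_eq_def comp_functor_def point_functor_def)
  from lift[OF nat_trans_point_functor[OF P.target.category_axioms f]
      is_functor_point_functor[OF P.source.category_axioms e1] this]
  obtain G \<alpha> where "nat_trans (point_cat x i) E (point_functor E e1) G \<alpha>"
    and P\<alpha>: "amap P (\<alpha> x) = f" and opc: "opcartesian E B P (\<alpha> x)" by blast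
  interpret \<alpha>: nat_trans "point_cat x i" E "point_functor E e1" G \<alpha> by fact
  \<comment> \<open>The codomain \<open>omap G x\<close> supplies the witness for
    \<open>e2\<close>.\<close>
  have "\<alpha> x \<in> Hom E e1 (omap G x)"
    using \<alpha>.component_in[of x] by (simp add: point_cat_def point_functor_def)
  then show "\<exists>e2\<in>Ob E. \<exists>\<phi>\<in>Hom E e1 e2. opcartesian E B P \<phi> \<and> amap P \<phi> = f"
    using P\<alpha> opc P.source.Hom_ends(2) by blast
qed

theorem proposition2p6:
  fixes E :: "('eo, 'ea) cat" and B :: "('bo, 'ba) cat"
    and P :: "('eo, 'ea, 'bo, 'ba) funct"
  assumes "is_functor E B P"
  shows "(grothendieck_opfibration E B P
            \<longrightarrow> right_directed_fibration TYPE('co \<times> 'ca) E B P)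
       \<and> (grothendieck_fibration E B P
            \<longrightarrow> left_directed_fibration TYPE('co \<times> 'ca) E B P)
       \<and> ((\<forall>(C :: ('co, 'ca) cat) F' G' \<alpha>' F.
              category C \<longrightarrow> is_functor C B F' \<longrightarrow> is_functor C B G'
              \<longrightarrow> nat_trans C B F' G' \<alpha>'
              \<longrightarrow> is_functor C E F \<longrightarrow> functor_eq C (comp_functor P F) F'
              \<longrightarrow> (\<exists>G \<alpha>. is_functor C E G \<and> functor_eq C (comp_functor P G) G'
                    \<and> nat_trans C E F G \<alpha>
                    \<and> (\<forall>c\<in>Ob C. amap P (\<alpha> c) = \<alpha>' c)
                    \<and> (\<forall>c\<in>Ob C. opcartesian E B P (\<alpha> c))))
            \<longrightarrow> grothendieck_opfibration E B P)"
proof (intro conjI impI)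
  assume "grothendieck_opfibration E B P"
  then show "right_directed_fibration TYPE('co \<times> 'ca) E B P"
    unfolding right_directed_fibration_def
    using directed_lifting_False_if_opfibration[OF assms] by blast
next
  assume "grothendieck_fibration E B P"
  \<comment> \<open>The opfibration result is applied to the opposite functor with test category
    \<open>op_cat C\<close>, and the lifting is then dualised back.\<close>
  then show "left_directed_fibration TYPE('co \<times> 'ca) E B P"
    unfolding left_directed_fibration_def grothendieck_fibration_def
    using directed_lifting_False_if_opfibration[OF is_functor_op_cat[OF assms]]
      directed_lifting_op_cat category_op_cat by blast
next
  assume lift: "\<forall>(C :: ('co, 'ca) cat) F' G' \<alpha>' F.
      category C \<longrightarrow> is_functor C B F' \<longrightarrow> is_functor C B G'
      \<longrightarrow> nat_trans C B F' G' \<alpha>'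
      \<longrightarrow> is_functor C E F \<longrightarrow> functor_eq C (comp_functor P F) F'
      \<longrightarrow> (\<exists>G \<alpha>. is_functor C E G \<and> functor_eq C (comp_functor P G) G'
            \<and> nat_trans C E F G \<alpha>
            \<and> (\<forall>c\<in>Ob C. amap P (\<alpha> c) = \<alpha>' c)
            \<and> (\<forall>c\<in>Ob C. opcartesian E B P (\<alpha> c)))"
  \<comment> \<open>Types are inhabited, so \<open>undefined\<close> provides an object and an arrow
    in the given carrier types.\<close>
  let ?pt = "point_cat undefined undefined :: ('co, 'ca) cat"
  have ob: "undefined \<in> Ob ?pt" by (simp add: point_cat_def)
  show "grothendieck_opfibration E B P"
  proof (rule opfibration_if_opcartesian_lifts[OF assms])
    fix F' G' \<alpha>' F
    assume \<alpha>': "nat_trans ?pt B F' G' \<alpha>'" and F: "is_functor ?pt E F"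
      and PF: "functor_eq ?pt (comp_functor P F) F'"
    interpret \<alpha>': nat_trans ?pt B F' G' \<alpha>' by fact
    show "\<exists>G \<alpha>. nat_trans ?pt E F G \<alpha> \<and> amap P (\<alpha> undefined) = \<alpha>' undefined
        \<and> opcartesian E B P (\<alpha> undefined)"
      using lift[rule_format, OF category_point_cat \<alpha>'.source.is_functor_axioms
          \<alpha>'.target.is_functor_axioms \<alpha>' F PF] ob by blast
  qed
qed

end
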